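(* Let $k\in\{1,2\}$ and let $\bar k$ be the other element of $\{1,2\}$. Let $X,Y$ be independent exponential random variables with means $1/\lambda_k$, $1/\lambda_{\bar k}$ ($\lambda_k,\lambda_{\bar k}>0$), and let $\sigma_k^2>0$, $p_s,p_w>0$, $\alpha_k\in(0,1]$, $\bar R_k>0$. Define $$\zeta_k=\Pr\Big\{\alpha_k\log_2\Big(1+\frac{p_sX}{\alpha_k\sigma_k^2}\Big)<\bar R_k,\ X>Y\Big\}+\Pr\Big\{\alpha_k\log_2\Big(1+\frac{p_wX}{\alpha_k\sigma_k^2}\Big)<\bar R_k,\ X\le Y\Big\}.$$ Then $$\zeta_k=1+\frac{\lambda_k}{\lambda_k+\lambda_{\bar k}}\Big(e^{-(\lambda_k+\lambda_{\bar k})\varphi_{k,1}}-e^{-(\lambda_k+\lambda_{\bar k})\varphi_{k,2}}\Big)-e^{-\lambda_k\varphi_{k,1}},$$ where $\varphi_{k,1}=\frac{\alpha_k\sigma_k^2\xi_k}{p_s}$, $\varphi_{k,2}=\frac{\alpha_k\sigma_k^2\xi_k}{p_w}$ and $\xi_k=2^{\bar R_k/\alpha_k}-1$.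
   Context: Interpretation: $\zeta_k$ is the outage probability of user $k$ at target rate $\bar R_k$ in a two-user downlink orthogonal multiple access scheme (OMA-Type-II) under partial channel state information, where $X=|h_k|^2$, $Y=|h_{\bar k}|^2$ are the channel gains, noise variances are equal, the currently stronger user is assigned fixed power $p_s$ and the weaker one $p_w$, and user $k$ gets a fixed fraction $\alpha_k$ of the time/frequency resource. *)

theory Defs
  imports "HOL-Probability.Probability"
begin

text \<open>
  Outage probability of a user with target rate \<open>R\<close> in the two-user OMA-Type-II downlink.
  \<open>X\<close> is the channel gain of the user under consideration and \<open>Y\<close> that of the other user;
  \<open>ps\<close> and \<open>pw\<close> are the powers of the currently stronger and weaker user, \<open>\<alpha>\<close> is the
  resource fraction of the user under consideration, and \<open>\<sigma>\<close> is the standard deviation of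
  the noise, so that the noise variance is \<open>\<sigma>\<^sup>2\<close>. A tie \<open>X = Y\<close> counts as weak.
\<close>

definition outage_prob ::
  "'a measure \<Rightarrow> ('a \<Rightarrow> real) \<Rightarrow> ('a \<Rightarrow> real) \<Rightarrow> real \<Rightarrow> real \<Rightarrow> real \<Rightarrow> real \<Rightarrow> real \<Rightarrow> real"
where
  "outage_prob M X Y ps pw \<alpha> \<sigma> R =
     \<P>(\<omega> in M. \<alpha> * log 2 (1 + ps * X \<omega> / (\<alpha> * \<sigma>\<^sup>2)) < R \<and> X \<omega> > Y \<omega>)
   + \<P>(\<omega> in M. \<alpha> * log 2 (1 + pw * X \<omega> / (\<alpha> * \<sigma>\<^sup>2)) < R \<and> X \<omega> \<le> Y \<omega>)"

definition snr_threshold :: "real \<Rightarrow> real \<Rightarrow> real" where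
  "snr_threshold \<alpha> R = 2 powr (R / \<alpha>) - 1"

definition gain_threshold :: "real \<Rightarrow> real \<Rightarrow> real \<Rightarrow> real \<Rightarrow> real" where
  "gain_threshold \<alpha> \<sigma> R p = \<alpha> * \<sigma>\<^sup>2 * snr_threshold \<alpha> R / p"

end

theory Submission
  imports Defs
begin

text \<open>
  Up to a null set the rate condition at power \<open>p\<close> reads \<open>X \<le> \<phi>\<close> for the threshold \<open>\<phi>\<close> of \<open>p\<close>.
  Hence the outage probability is
  \<open>P(X \<le> \<phi>1) - P(X \<le> \<phi>1, X \<le> Y) + P(X \<le> \<phi>2, X \<le> Y)\<close>. Integrating the tail of \<open>Y\<close> against
  the density of \<open>X\<close> turns \<open>P(X \<le> a, X \<le> Y)\<close> into \<open>l / (l + u)\<close> times the distribution function of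
  an exponential variable of rate \<open>l + u\<close>.
\<close>

text \<open>A law with a Lebesgue density has no atoms; this is what lets strict and weak
  inequalities be exchanged up to a null set.\<close>

lemma (in prob_space) AE_distributed_lborel_neq:
  fixes X :: "'a \<Rightarrow> real"
  assumes "distributed M lborel X f"
  shows "AE \<omega> in M. X \<omega> \<noteq> a"
proof -
  have "AE x in lborel. x \<noteq> a"
    by (rule AE_lborel_singleton)
  then show ?thesis
    by (subst distributed_AE2[OF assms]) auto
qed

lemma (in prob_space) AE_exponential_distributed_nonneg:
  assumes "distributed M lborel X (exponential_density l)"
  shows "AE \<omega> in M. 0 \<le> X \<omega>"
  by (subst distributed_AE2[OF assms]) (auto simp: exponential_density_def)

lemma (in prob_space) exponential_distributedD_ge:
  assumes D: "distributed M lborel X (exponential_density l)" and "0 \<le> a" "0 < l"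
  shows "\<P>(\<omega> in M. a \<le> X \<omega>) = exp (- a * l)"
proof -
  have [measurable]: "X \<in> borel_measurable M"
    using distributed_measurable[OF D] by simp
  have "\<P>(\<omega> in M. a \<le> X \<omega>) = \<P>(\<omega> in M. a < X \<omega>)"
    by (rule finite_measure_eq_AE) (use AE_distributed_lborel_neq[OF D, of a] in auto)
  also have "\<dots> = exp (- a * l)"
    by (rule exponential_distributedD_gt) fact+
  finally show ?thesis .
qed

text \<open>Probabilistic reading: on \<open>X \<le> Y\<close> the value of \<open>X\<close> is the
  minimum of the pair. That minimum is exponential of rate \<open>l + u\<close> and independent of
  which variable attains it; \<open>X\<close> does so with probability
  \<open>l / (l + u)\<close>.\<close>

lemma (in prob_space) prob_exponential_le_and_le:
  assumes X: "distributed M lborel X (exponential_density l)"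
    and Y: "distributed M lborel Y (exponential_density u)"
    and ind: "indep_var borel X borel Y"
    and l: "0 < l" and u: "0 < u" and a: "0 \<le> a"
  shows "\<P>(\<omega> in M. X \<omega> \<le> a \<and> X \<omega> \<le> Y \<omega>) = l / (l + u) * (1 - exp (- (l + u) * a))"
proof -
  have [measurable]: "X \<in> borel_measurable M" "Y \<in> borel_measurable M"
    using distributed_measurable[OF X] distributed_measurable[OF Y] by simp_all
  interpret DY: prob_space "distr M borel Y"
    by (rule prob_space_distr) simp
  define A :: "(real \<times> real) set" where "A = {p. fst p \<le> a \<and> fst p \<le> snd p}"
  have [measurable]: "A \<in> sets (borel \<Otimes>\<^sub>M borel)"
    unfolding borel_prod A_def
    by (intro borel_closed closed_Collect_conj closed_Collect_le continuous_intros)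
  have distr_X: "distr M borel X = density lborel (exponential_density l)"
    using distributed_distr_eq_density[OF X] by (simp cong: distr_cong)
  have tail: "emeasure (distr M borel Y) {x..} = exp (- x * u)" if "0 \<le> x" for x
    using exponential_distributedD_ge[OF Y that u]
    by (subst emeasure_distr) (auto simp: emeasure_eq_measure vimage_def Int_def conj_commute)
  \<comment> \<open>For \<open>x\<close> between 0 and \<open>a\<close> the section of
    \<open>A\<close> is the tail \<open>{x..}\<close>, and the exponents of density and tail add up
    to rate \<open>l + u\<close>; the factor \<open>l / (l + u)\<close> corrects the normalisation.
    For \<open>x < 0\<close> both densities vanish, and for \<open>x > a\<close> the section is
    empty and the indicator is 0.\<close>
  have integrand: "exponential_density l x * emeasure (distr M borel Y) (Pair x -` A)
      = ennreal (l / (l + u)) * (ennreal (exponential_density (l + u) x) * indicator {..a} x)" for x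
  proof (cases "0 \<le> x \<and> x \<le> a")
    case True
    then have "Pair x -` A = {x..}"
      by (auto simp: A_def)
    moreover have "exponential_density l x * exp (- x * u)
        = l / (l + u) * exponential_density (l + u) x"
      using True l u by (auto simp: exponential_density_def field_simps simp flip: exp_add)
    ultimately show ?thesis
      using True l u
      by (simp add: tail exponential_density_nonneg flip: ennreal_mult)
  next
    case False
    then show ?thesis
      by (auto simp: A_def exponential_density_def)
  qed
  have "emeasure M {\<omega> \<in> space M. X \<omega> \<le> a \<and> X \<omega> \<le> Y \<omega>}
      = emeasure (distr M (borel \<Otimes>\<^sub>M borel) (\<lambda>\<omega>. (X \<omega>, Y \<omega>))) A"
  proof -
    have "{\<omega> \<in> space M. X \<omega> \<le> a \<and> X \<omega> \<le> Y \<omega>} = (\<lambda>\<omega>. (X \<omega>, Y \<omega>)) -` A \<inter> space M"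
      by (auto simp: A_def)
    then show ?thesis
      by (simp add: emeasure_distr)
  qed
  also have "\<dots> = emeasure (distr M borel X \<Otimes>\<^sub>M distr M borel Y) A"
    using ind by (simp add: indep_var_distribution_eq)
  also have "\<dots> = (\<integral>\<^sup>+x. emeasure (distr M borel Y) (Pair x -` A) \<partial>distr M borel X)"
    by (rule DY.emeasure_pair_measure_alt) (simp cong: sets_pair_measure_cong)
  also have "\<dots> = (\<integral>\<^sup>+x. exponential_density l x * emeasure (distr M borel Y) (Pair x -` A) \<partial>lborel)"
    unfolding distr_X
    by (subst nn_integral_density)
      (auto intro!: DY.measurable_emeasure_Pair simp: sets_pair_measure_cong[of lborel borel "distr M borel Y" borel])
  also have "\<dots> = ennreal (l / (l + u)) *
      emeasure (density lborel (exponential_density (l + u))) {..a}"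
    unfolding integrand by (simp add: nn_integral_cmult emeasure_density)
  \<comment> \<open>The exponential density is the Erlang density of shape 0, so the sum in
    \<open>erlang_CDF\<close> has a single term.\<close>
  also have "\<dots> = ennreal (l / (l + u) * (1 - exp (- (l + u) * a)))"
    using l u a
    by (simp add: emeasure_erlang_density erlang_CDF_def mult.commute flip: ennreal_mult')
  finally have "ennreal (\<P>(\<omega> in M. X \<omega> \<le> a \<and> X \<omega> \<le> Y \<omega>))
      = ennreal (l / (l + u) * (1 - exp (- (l + u) * a)))"
    unfolding emeasure_eq_measure .
  \<comment> \<open>\<open>ennreal\<close> sends negative reals to 0, so cancelling it requires both
    sides to be nonnegative.\<close>
  moreover have "0 \<le> l / (l + u) * (1 - exp (- (l + u) * a))"
    using l u a by (intro mult_nonneg_nonneg) (auto simp: mult_nonpos_nonneg)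
  ultimately show ?thesis
    by (subst (asm) ennreal_inj) auto
qed

text \<open>The rate is strictly increasing in the gain, and the threshold is the gain at which it
  equals \<open>R\<close>. With \<open>0 \<le> x\<close> the argument of the logarithm is positive,
  so the inequality can be exponentiated.\<close>

lemma rate_less_iff_less_gain_threshold:
  assumes "0 < \<alpha>" "0 < \<sigma>\<^sup>2" "0 < p" "0 \<le> x"
  shows "\<alpha> * log 2 (1 + p * x / (\<alpha> * \<sigma>\<^sup>2)) < R \<longleftrightarrow> x < gain_threshold \<alpha> \<sigma> R p"
proof -
  have pos: "0 < 1 + p * x / (\<alpha> * \<sigma>\<^sup>2)"
    using assms by (intro add_pos_nonneg) auto
  have "\<alpha> * log 2 (1 + p * x / (\<alpha> * \<sigma>\<^sup>2)) < R \<longleftrightarrow> log 2 (1 + p * x / (\<alpha> * \<sigma>\<^sup>2)) < R / \<alpha>"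
    using assms by (simp add: field_simps)
  also have "\<dots> \<longleftrightarrow> 1 + p * x / (\<alpha> * \<sigma>\<^sup>2) < 2 powr (R / \<alpha>)"
    using pos by (simp add: log_less_iff)
  also have "\<dots> \<longleftrightarrow> p * x / (\<alpha> * \<sigma>\<^sup>2) < snr_threshold \<alpha> R"
    by (auto simp: snr_threshold_def)
  also have "\<dots> \<longleftrightarrow> x < gain_threshold \<alpha> \<sigma> R p"
    using assms by (simp add: gain_threshold_def pos_divide_less_eq pos_less_divide_eq mult.commute)
  finally show ?thesis .
qed

text \<open>The closed forms for the exponential probabilities are valid only at nonnegative
  arguments, so the thresholds must be checked.\<close>

lemma gain_threshold_nonneg:
  assumes "0 < \<alpha>" "0 \<le> R" "0 < p"
  shows "0 \<le> gain_threshold \<alpha> \<sigma> R p"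
  using assms ge_one_powr_ge_zero[of 2 "R / \<alpha>"] by (simp add: gain_threshold_def snr_threshold_def)

theorem proposition4p4:
  fixes M :: "'a measure"
    and X Y :: "'a \<Rightarrow> real"
    and k kbar :: nat
    and lam \<alpha> \<sigma> R :: "nat \<Rightarrow> real"
    and ps pw \<phi>1 \<phi>2 :: real
  assumes "prob_space M"
    and "{k, kbar} = {1, 2}"
    and "lam k > 0" and "lam kbar > 0"
    and "distributed M lborel X (exponential_density (lam k))"
    and "distributed M lborel Y (exponential_density (lam kbar))"
    and "prob_space.indep_var M borel X borel Y"
    and "(\<sigma> k)\<^sup>2 > 0"
    and "ps > 0" and "pw > 0"
    and "0 < \<alpha> k" and "\<alpha> k \<le> 1"
    and "R k > 0"
    and "\<phi>1 = gain_threshold (\<alpha> k) (\<sigma> k) (R k) ps"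
    and "\<phi>2 = gain_threshold (\<alpha> k) (\<sigma> k) (R k) pw"
  shows "outage_prob M X Y ps pw (\<alpha> k) (\<sigma> k) (R k) =
    1 + lam k / (lam k + lam kbar)
          * (exp (- (lam k + lam kbar) * \<phi>1) - exp (- (lam k + lam kbar) * \<phi>2))
      - exp (- lam k * \<phi>1)"
proof -
  interpret prob_space M by fact
  note X = assms(5) and Y = assms(6)
  have [measurable]: "X \<in> borel_measurable M" "Y \<in> borel_measurable M"
    using distributed_measurable[OF X] distributed_measurable[OF Y] by simp_all
  have \<phi>_nonneg: "0 \<le> \<phi>1" "0 \<le> \<phi>2"
    using assms by (simp_all add: gain_threshold_nonneg)
  \<comment> \<open>Nonnegativity of \<open>X\<close> gives access to the threshold form; discarding
    \<open>X \<omega> = \<phi>1\<close> turns \<open><\<close> into \<open>\<le>\<close>, the form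
    used by the distribution function and by \<open>weak\<close>.\<close>
  have outage1: "AE \<omega> in M. \<alpha> k * log 2 (1 + ps * X \<omega> / (\<alpha> k * (\<sigma> k)\<^sup>2)) < R k \<longleftrightarrow> X \<omega> \<le> \<phi>1"
    using AE_exponential_distributed_nonneg[OF X] AE_distributed_lborel_neq[OF X, of \<phi>1]
    by eventually_elim (use assms rate_less_iff_less_gain_threshold in auto)
  have outage2: "AE \<omega> in M. \<alpha> k * log 2 (1 + pw * X \<omega> / (\<alpha> k * (\<sigma> k)\<^sup>2)) < R k \<longleftrightarrow> X \<omega> \<le> \<phi>2"
    using AE_exponential_distributed_nonneg[OF X] AE_distributed_lborel_neq[OF X, of \<phi>2]
    by eventually_elim (use assms rate_less_iff_less_gain_threshold in auto)
  have weak: "\<P>(\<omega> in M. X \<omega> \<le> a \<and> X \<omega> \<le> Y \<omega>)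
      = lam k / (lam k + lam kbar) * (1 - exp (- (lam k + lam kbar) * a))" if "0 \<le> a" for a
    by (rule prob_exponential_le_and_le) (use assms that in auto)
  have "\<P>(\<omega> in M. \<alpha> k * log 2 (1 + ps * X \<omega> / (\<alpha> k * (\<sigma> k)\<^sup>2)) < R k \<and> X \<omega> > Y \<omega>)
      = \<P>(\<omega> in M. X \<omega> \<le> \<phi>1 \<and> X \<omega> > Y \<omega>)"
    by (rule finite_measure_eq_AE) (use outage1 in auto)
  \<comment> \<open>Passing to the complement inside \<open>X \<le> \<phi>1\<close> reduces the
    strong case to the event of \<open>weak\<close>, so one formula serves both powers.\<close>
  also have "\<dots> = prob ({\<omega> \<in> space M. X \<omega> \<le> \<phi>1} - {\<omega> \<in> space M. X \<omega> \<le> \<phi>1 \<and> X \<omega> \<le> Y \<omega>})"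
    by (rule arg_cong[where f = prob]) auto
  also have "\<dots> = \<P>(\<omega> in M. X \<omega> \<le> \<phi>1) - \<P>(\<omega> in M. X \<omega> \<le> \<phi>1 \<and> X \<omega> \<le> Y \<omega>)"
    by (rule finite_measure_Diff) auto
  finally have strong: "\<P>(\<omega> in M. \<alpha> k * log 2 (1 + ps * X \<omega> / (\<alpha> k * (\<sigma> k)\<^sup>2)) < R k \<and> X \<omega> > Y \<omega>)
      = \<P>(\<omega> in M. X \<omega> \<le> \<phi>1) - \<P>(\<omega> in M. X \<omega> \<le> \<phi>1 \<and> X \<omega> \<le> Y \<omega>)" .
  have "\<P>(\<omega> in M. \<alpha> k * log 2 (1 + pw * X \<omega> / (\<alpha> k * (\<sigma> k)\<^sup>2)) < R k \<and> X \<omega> \<le> Y \<omega>)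
      = \<P>(\<omega> in M. X \<omega> \<le> \<phi>2 \<and> X \<omega> \<le> Y \<omega>)"
    by (rule finite_measure_eq_AE) (use outage2 in auto)
  \<comment> \<open>The constant terms \<open>lam k / (lam k + lam kbar)\<close> from the two uses
    of \<open>weak\<close> cancel, leaving the difference of exponentials.\<close>
  then show ?thesis
    using exponential_distributedD_le[OF X \<phi>_nonneg(1) assms(3)]
    unfolding outage_prob_def strong weak[OF \<phi>_nonneg(1)]
    by (simp add: weak[OF \<phi>_nonneg(2)] algebra_simps)
qed

end
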